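(* Let $n>1$ be an odd integer. Then $$\sum_{k=0}^{n-1}\frac{(q;q^2)_k}{(q;q)_k}q^{2k}\equiv(-1)^{(n-1)/2}q^{(n^2-5)/4}+\frac{q-1}{q}[n]\pmod{\Phi_n(q)^2}$$ and $$\sum_{k=0}^{n-1}\frac{(q^3;q^2)_k}{(q;q)_k}q^k\equiv(-1)^{(n+1)/2}q^{(n^2-9)/4}+\frac{1+q}{q^2}[n]\pmod{\Phi_n(q)^2}.$$
   Context: The $q$-Pochhammer symbol is defined by $(x;q)_0=1$ and $(x;q)_k=(1-x)(1-xq)\cdots(1-xq^{k-1})$ for $k\ge1$. The $q$-integer is $[n]=1+q+\cdots+q^{n-1}$. $\Phi_n(q)$ denotes the $n$-th cyclotomic polynomial. For rational functions $A(q),B(q)$ in $q$, $A(q)\equiv B(q)\pmod{\Phi_n(q)^2}$ means that $A(q)-B(q)$ can be written as $P(q)/Q(q)$ with polynomials $P,Q$ such that $\Phi_n(q)^2$ divides $P(q)$ and $Q(q)$ is coprime to $\Phi_n(q)$. *)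

theory Defs
  imports "HOL-Computational_Algebra.Computational_Algebra"
begin

definition qpochhammer :: "'a::comm_ring_1 \<Rightarrow> 'a \<Rightarrow> nat \<Rightarrow> 'a" where
  "qpochhammer x q k = (\<Prod>i<k. 1 - x * q ^ i)"

definition qint :: "'a::comm_semiring_1 \<Rightarrow> nat \<Rightarrow> 'a" where
  "qint q n = (\<Sum>i<n. q ^ i)"

(* The indeterminate of the field of rational functions over the rationals. *)
definition qvar :: "rat poly fract" where
  "qvar = to_fract [:0, 1:]"

definition primitive_unity_roots :: "nat \<Rightarrow> complex set" where
  "primitive_unity_roots n = {z. z ^ n = 1 \<and> (\<forall>m. 0 < m \<and> m < n \<longrightarrow> z ^ m \<noteq> 1)}"

(* The product over the primitive n-th roots of unity has rational coefficients for n > 0, so the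
   description below denotes (see map_poly_cyclotomic). *)
definition cyclotomic :: "nat \<Rightarrow> rat poly" where
  "cyclotomic n = (THE p. map_poly of_rat p = (\<Prod>z\<in>primitive_unity_roots n. [:- z, 1:]))"

definition cong_mod_square :: "rat poly \<Rightarrow> rat poly fract \<Rightarrow> rat poly fract \<Rightarrow> bool" where
  "cong_mod_square p A B \<longleftrightarrow>
     (\<exists>P Q. Q \<noteq> 0 \<and> A - B = Fract P Q \<and> p\<^sup>2 dvd P \<and> coprime Q p)"

abbreviation crp :: "rat poly \<Rightarrow> complex poly" where
  "crp \<equiv> map_poly of_rat"

lemma crp_mult: "crp (p * q) = crp p * crp q"
  by (simp add: poly_eq_iff coeff_map_poly coeff_mult of_rat_sum of_rat_mult)

lemma crp_add: "crp (p + q) = crp p + crp q"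
  by (simp add: poly_eq_iff coeff_map_poly of_rat_add)

lemma crp_prod: "crp (\<Prod>i\<in>A. f i) = (\<Prod>i\<in>A. crp (f i))"
  by (induction A rule: infinite_finite_induct) (auto simp: crp_mult)

lemma crp_inject: "crp p = crp q \<longleftrightarrow> p = q"
  by (auto simp: poly_eq_iff coeff_map_poly)

lemma crp_degree: "degree (crp p) = degree p"
  by (intro degree_map_poly) auto

lemma crp_0_iff: "crp p = 0 \<longleftrightarrow> p = 0"
  using crp_inject[of p 0] by simp

lemma crp_dvd_quotient:
  assumes "crp p = crp b * c" "b \<noteq> 0"
  shows "\<exists>a. c = crp a"
proof -
  have "crp b * c = crp b * crp (p div b) + crp (p mod b)"
    using assms(1) by (metis crp_add crp_mult mult_div_mod_eq)
  hence eq: "crp b * (c - crp (p div b)) = crp (p mod b)"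
    by (simp add: algebra_simps)
  have "c - crp (p div b) = 0"
  proof (rule ccontr)
    assume nz: "c - crp (p div b) \<noteq> 0"
    have b: "crp b \<noteq> 0" using assms(2) by (simp add: crp_0_iff)
    have ne: "p mod b \<noteq> 0" using eq nz b by auto
    have "degree (p mod b) = degree b + degree (c - crp (p div b))"
      using degree_mult_eq[OF b nz] eq by (simp add: crp_degree)
    moreover have "degree (p mod b) < degree b"
      using ne degree_mod_less[of b p] assms(2) by auto
    ultimately show False by simp
  qed
  thus ?thesis by auto
qed

lemma unity_roots_decompose:
  assumes "n > 0"
  shows "{z::complex. z ^ n = 1} = (\<Union>d\<in>{d. d dvd n}. primitive_unity_roots d)"
proof (intro equalityI subsetI)
  fix z :: complex assume z: "z \<in> {z. z ^ n = 1}"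
  define d where "d = (LEAST d. d > 0 \<and> z ^ d = 1)"
  have d: "d > 0 \<and> z ^ d = 1"
    unfolding d_def by (rule LeastI[of _ n]) (use assms z in auto)
  have min: "z ^ m \<noteq> 1" if "0 < m" "m < d" for m
    using not_less_Least[of m "\<lambda>d. d > 0 \<and> z ^ d = 1"] that unfolding d_def by auto
  have "z ^ (n mod d) = z ^ (d * (n div d) + n mod d)"
    using d by (simp only: power_add power_mult) simp
  also have "\<dots> = 1" using z by simp
  finally have "n mod d = 0"
    using min[of "n mod d"] d by (cases "n mod d = 0") auto
  with d min show "z \<in> (\<Union>d\<in>{d. d dvd n}. primitive_unity_roots d)"
    by (auto simp: primitive_unity_roots_def)
next
  fix z :: complex assume "z \<in> (\<Union>d\<in>{d. d dvd n}. primitive_unity_roots d)"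
  then obtain d k where "n = d * k" "z ^ d = 1"
    unfolding primitive_unity_roots_def by blast
  thus "z \<in> {z. z ^ n = 1}" by (simp add: power_mult)
qed

lemma primitive_unity_roots_disjoint:
  assumes "0 < d" "0 < e" "d \<noteq> e"
  shows "primitive_unity_roots d \<inter> primitive_unity_roots e = {}"
  using assms by (cases "d < e") (auto simp: primitive_unity_roots_def)

lemma finite_primitive_unity_roots: "n > 0 \<Longrightarrow> finite (primitive_unity_roots n)"
  by (rule finite_subset[OF _ finite_roots_unity[of n]]) (auto simp: primitive_unity_roots_def)

lemma prod_unity_roots:
  assumes "n > 0"
  shows "(\<Prod>z\<in>{z::complex. z ^ n = 1}. [:- z, 1:]) = monom 1 n - 1"
proof (rule poly_eqI_degree_lead_coeff[where n = n and A = "{z. z ^ n = 1}"])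
  have fin: "finite {z::complex. z ^ n = 1}" using assms by (simp add: finite_roots_unity)
  have card: "card {z::complex. z ^ n = 1} = n" using assms by (simp add: card_roots_unity_eq)
  show "n \<le> card {z::complex. z ^ n = 1}" using card by simp
  have deg: "degree (\<Prod>z\<in>{z::complex. z ^ n = 1}. [:- z, 1:]) = n"
    using card by (subst degree_prod_eq_sum_degree) auto
  thus "degree (\<Prod>z\<in>{z::complex. z ^ n = 1}. [:- z, 1:]) \<le> n" by simp
  show "degree (monom 1 n - 1 :: complex poly) \<le> n"
    by (intro degree_diff_le) (auto simp: degree_monom_eq)
  have "lead_coeff (\<Prod>z\<in>{z::complex. z ^ n = 1}. [:- z, 1:]) = 1"
    by (simp add: lead_coeff_prod)
  thus "coeff (\<Prod>z\<in>{z::complex. z ^ n = 1}. [:- z, 1:]) n = coeff (monom 1 n - 1) n"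
    using deg assms by (simp add: one_pCons coeff_pCons split: nat.split)
  fix z :: complex assume z: "z \<in> {z. z ^ n = 1}"
  have "poly (\<Prod>z\<in>{z::complex. z ^ n = 1}. [:- z, 1:]) z = 0"
    unfolding poly_prod using fin z by (intro prod_zero) auto
  thus "poly (\<Prod>z\<in>{z::complex. z ^ n = 1}. [:- z, 1:]) z = poly (monom 1 n - 1) z"
    using z by (simp add: poly_monom)
qed

lemma cyclotomic_exists:
  assumes "n > 0"
  shows "\<exists>p. crp p = (\<Prod>z\<in>primitive_unity_roots n. [:- z, 1:])"
  using assms
proof (induction n rule: less_induct)
  case (less n)
  define D where "D = {d. d dvd n \<and> d \<noteq> n}"
  have D: "0 < d" "d < n" if "d \<in> D" for d
    using that less.prems dvd_imp_le[of d n] unfolding D_def by (auto intro: Nat.gr0I)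
  have fin: "finite D" unfolding D_def using less.prems by (auto intro: finite_subset[of _ "{..n}"] dvd_imp_le)
  have "\<forall>d\<in>D. \<exists>p. crp p = (\<Prod>z\<in>primitive_unity_roots d. [:- z, 1:])"
    using less.IH D by blast
  then obtain f where f: "\<And>d. d \<in> D \<Longrightarrow> crp (f d) = (\<Prod>z\<in>primitive_unity_roots d. [:- z, 1:])"
    by metis
  have split: "{d. d dvd n} = insert n D" by (auto simp: D_def)
  have "crp (monom 1 n - 1) = monom 1 n - 1"
    by (simp add: poly_eq_iff coeff_map_poly of_rat_diff coeff_monom one_pCons coeff_pCons split: nat.split)
  also have "\<dots> = (\<Prod>z\<in>{z::complex. z ^ n = 1}. [:- z, 1:])"
    using less.prems by (simp add: prod_unity_roots)
  also have "\<dots> = (\<Prod>d\<in>insert n D. \<Prod>z\<in>primitive_unity_roots d. [:- z, 1:])"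
    unfolding unity_roots_decompose[OF less.prems] split
    using fin D less.prems
    by (intro prod.UNION_disjoint ballI impI primitive_unity_roots_disjoint)
       (auto intro!: finite_primitive_unity_roots)
  also have "\<dots> = (\<Prod>z\<in>primitive_unity_roots n. [:- z, 1:]) * crp (\<Prod>d\<in>D. f d)"
    using fin by (subst prod.insert) (auto simp: D_def[symmetric] crp_prod f, simp add: D_def)
  finally have eq: "crp (monom 1 n - 1) = crp (\<Prod>d\<in>D. f d) * (\<Prod>z\<in>primitive_unity_roots n. [:- z, 1:])"
    by (simp add: mult.commute)
  have "f d \<noteq> 0" if "d \<in> D" for d
  proof
    assume "f d = 0"
    with f[OF that] have "(\<Prod>z\<in>primitive_unity_roots d. [:- z, 1:]) = 0" by simp
    thus False using D[OF that] by (simp add: finite_primitive_unity_roots)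
  qed
  hence "(\<Prod>d\<in>D. f d) \<noteq> 0" using fin by simp
  from crp_dvd_quotient[OF eq this] show ?case by metis
qed

lemma map_poly_cyclotomic:
  assumes "n > 0"
  shows "map_poly of_rat (cyclotomic n) = (\<Prod>z\<in>primitive_unity_roots n. [:- z, 1:])"
proof -
  from cyclotomic_exists[OF assms] obtain p
    where p: "crp p = (\<Prod>z\<in>primitive_unity_roots n. [:- z, 1:])" by blast
  show ?thesis
    unfolding cyclotomic_def
  proof (rule theI)
    show "crp p = (\<Prod>z\<in>primitive_unity_roots n. [:- z, 1:])" by (fact p)
    show "r = p" if "crp r = (\<Prod>z\<in>primitive_unity_roots n. [:- z, 1:])" for r
      using that unfolding p[symmetric] crp_inject .
  qed
qed

end

(*
  Put F(q, x) = \<Sum>k<n. (x;q^2)_k / (q;q)_k q^k. A telescoping argument relates F(q, x) to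
  F(q, x q^2), to the sum with q^(2k) in place of q^k, and to the product (x;q^2)_n / (q;q)_(n-1).
  At x = q this product is 1 - q^n modulo the square of the cyclotomic polynomial, so both
  congruences reduce to F(q, q) = (-1)^m q^(m(m+1)) modulo that square, where n = 2m + 1.
  The functional equation gives F(q, q^(-2j)) = (-1)^j q^(-j^2) exactly for j < n, in particular at
  x = q^(1-n), which is congruent to q modulo the cyclotomic polynomial. It remains to find the
  x-derivative of F at q = x = \<zeta>, a primitive n-th root of unity. The values at the n points
  \<zeta>^(-2j) determine F(\<zeta>, x) as a polynomial in x, and show that its coefficients c_i satisfy
  c_(2m-i) \<zeta>^(2m-i) = c_i \<zeta>^i; hence \<zeta> F_x(\<zeta>, \<zeta>) = m F(\<zeta>, \<zeta>).
*)

theory Submission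
  imports Defs
begin

section \<open>The truncated series and its functional equation\<close>

lemma qpochhammer_0 [simp]: "qpochhammer x q 0 = 1"
  by (simp add: qpochhammer_def)

lemma qpochhammer_Suc: "qpochhammer x q (Suc k) = qpochhammer x q k * (1 - x * q ^ k)"
  by (simp add: qpochhammer_def)

lemma qpochhammer_Suc_shift: "qpochhammer x q (Suc k) = (1 - x) * qpochhammer (x * q) q k"
  unfolding qpochhammer_def by (subst prod.lessThan_Suc_shift) (simp add: mult.assoc)

lemma qpochhammer_self_nonzero:
  fixes q :: "'a::field"
  assumes "\<And>i. 0 < i \<Longrightarrow> i \<le> k \<Longrightarrow> q ^ i \<noteq> 1"
  shows "qpochhammer q q k \<noteq> 0"
  using assms by (auto simp: qpochhammer_def simp flip: power_Suc)

definition qsum :: "nat \<Rightarrow> 'a::field \<Rightarrow> 'a \<Rightarrow> 'a" where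
  "qsum n q x = (\<Sum>k<n. qpochhammer x (q\<^sup>2) k / qpochhammer q q k * q ^ k)"

text \<open>Induction on N. The new terms of the two sums share the factor \<open>W\<close>, because
  (x;q^2)_(N+1) = (1 - x) \<open>W\<close> and (x q^2;q^2)_(N+1) = \<open>W\<close> (1 - x
  \<open>a\<close>^2). After cancelling it, a polynomial identity in x, q and \<open>a\<close> =
  q^(N+1) remains.\<close>

lemma qsum_functional_equation:
  fixes q :: "'a::field"
  assumes "\<And>i. 0 < i \<Longrightarrow> i \<le> N \<Longrightarrow> q ^ i \<noteq> 1"
  shows "qsum (Suc N) q x + x * q * qsum (Suc N) q (x * q\<^sup>2)
    = (1 + x * q ^ Suc N) * qpochhammer (x * q\<^sup>2) (q\<^sup>2) N / qpochhammer q q N"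
  using assms
proof (induction N)
  case 0
  show ?case by (simp add: qsum_def)
next
  case (Suc N)
  define W where "W = qpochhammer (x * q\<^sup>2) (q\<^sup>2) N"
  define D where "D = qpochhammer q q N"
  define a where "a = q ^ Suc N"
  have D: "D \<noteq> 0" unfolding D_def using Suc.prems by (intro qpochhammer_self_nonzero) auto
  have a: "1 - a \<noteq> 0" using Suc.prems[of "Suc N"] by (simp add: a_def)
  have D': "qpochhammer q q (Suc N) = D * (1 - a)"
    by (simp add: qpochhammer_Suc D_def a_def)
  have W1: "qpochhammer x (q\<^sup>2) (Suc N) = (1 - x) * W"
    by (simp add: qpochhammer_Suc_shift W_def)
  have W2: "qpochhammer (x * q\<^sup>2) (q\<^sup>2) (Suc N) = W * (1 - x * a\<^sup>2)"
    by (simp add: qpochhammer_Suc W_def a_def power2_eq_square power_mult_distrib mult_ac)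
  have IH: "qsum (Suc N) q x + x * q * qsum (Suc N) q (x * q\<^sup>2) = (1 + x * a) * W / D"
    unfolding W_def D_def a_def using Suc.prems by (intro Suc.IH) auto
  have rec: "qsum (Suc (Suc N)) q y
      = qsum (Suc N) q y + qpochhammer y (q\<^sup>2) (Suc N) / (D * (1 - a)) * a" for y
    unfolding qsum_def by (subst sum.lessThan_Suc) (simp add: D' a_def)
  have "qsum (Suc (Suc N)) q x + x * q * qsum (Suc (Suc N)) q (x * q\<^sup>2)
      = (1 + x * a) * W / D + ((1 - x) * W + x * q * (W * (1 - x * a\<^sup>2))) / (D * (1 - a)) * a"
    unfolding rec W1 W2 IH[symmetric] by (simp add: algebra_simps add_divide_distrib diff_divide_distrib)
  also have "\<dots> = (1 + x * (q * a)) * (W * (1 - x * a\<^sup>2)) / (D * (1 - a))"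
    using D a by (simp add: divide_simps) algebra
  finally show ?case
    unfolding W2 D' by (simp add: a_def)
qed

text \<open>Since x q^(2k) = 1 - (1 - x q^(2k)), the k-th term on the left is ((x;q^2)_k -
  (x;q^2)_(k+1)) / (q;q)_k. Summation by parts with 1/(q;q)_k - 1/(q;q)_(k-1) = q^k/(q;q)_k leaves F
  and one boundary term; the induction performs it step by step.\<close>

lemma qsum_q2_telescope:
  fixes q :: "'a::field"
  assumes "\<And>i. 0 < i \<Longrightarrow> i \<le> N \<Longrightarrow> q ^ i \<noteq> 1"
  shows "x * (\<Sum>k<Suc N. qpochhammer x (q\<^sup>2) k / qpochhammer q q k * q ^ (2 * k))
    = qsum (Suc N) q x - qpochhammer x (q\<^sup>2) (Suc N) / qpochhammer q q N"
  using assms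
proof (induction N)
  case 0
  show ?case by (simp add: qsum_def qpochhammer_Suc)
next
  case (Suc N)
  define W where "W = qpochhammer x (q\<^sup>2) (Suc N)"
  define D where "D = qpochhammer q q N"
  define a where "a = q ^ Suc N"
  have D: "D \<noteq> 0" unfolding D_def using Suc.prems by (intro qpochhammer_self_nonzero) auto
  have a: "1 - a \<noteq> 0" using Suc.prems[of "Suc N"] by (simp add: a_def)
  have D': "qpochhammer q q (Suc N) = D * (1 - a)"
    by (simp add: qpochhammer_Suc D_def a_def)
  have a2: "q ^ (2 * Suc N) = a\<^sup>2" by (metis a_def mult.commute power_mult)
  have W': "qpochhammer x (q\<^sup>2) (Suc (Suc N)) = W * (1 - x * a\<^sup>2)"
    by (subst qpochhammer_Suc) (simp add: W_def a_def power2_eq_square power_mult_distrib)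
  have IH: "x * (\<Sum>k<Suc N. qpochhammer x (q\<^sup>2) k / qpochhammer q q k * q ^ (2 * k))
      = qsum (Suc N) q x - W / D"
    unfolding W_def D_def using Suc.prems by (intro Suc.IH) auto
  have rec: "qsum (Suc (Suc N)) q x = qsum (Suc N) q x + W / (D * (1 - a)) * a"
    unfolding qsum_def by (subst sum.lessThan_Suc) (simp add: D' a_def W_def)
  have "x * (\<Sum>k<Suc (Suc N). qpochhammer x (q\<^sup>2) k / qpochhammer q q k * q ^ (2 * k))
      = qsum (Suc N) q x - W / D + x * (W / (D * (1 - a)) * a\<^sup>2)"
    by (subst sum.lessThan_Suc) (simp only: distrib_left IH D' a2 flip: W_def)
  also have "\<dots> = qsum (Suc N) q x + W / (D * (1 - a)) * a - W * (1 - x * a\<^sup>2) / (D * (1 - a))"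
    using D a by (simp add: divide_simps) algebra
  finally show ?case
    unfolding W' D' rec .
qed

lemma qsum_at_one: "qsum (Suc N) q 1 = 1"
  unfolding qsum_def by (subst sum.lessThan_Suc_shift) (simp add: qpochhammer_Suc_shift)

lemma qpochhammer_inverse_power_eq_0:
  fixes q :: "'a::field"
  assumes "q \<noteq> 0" "j < k"
  shows "qpochhammer (inverse q ^ j) q k = 0"
  using assms by (auto simp: qpochhammer_def power_inverse intro!: bexI[of _ j])

text \<open>At x = q^(-2(j+1)) with j < N the product in the functional equation contains the factor
  1 - q^(-2j) q^(2j) = 0. This leaves F(x) = - x q F(x q^2) with x q = q^(-(2j+1)); starting from
  F(1) = 1, the odd exponents add up to a square.\<close>

lemma qsum_at_inverse_power:
  fixes q :: "'a::field"
  assumes "q \<noteq> 0" and "\<And>i. 0 < i \<Longrightarrow> i \<le> N \<Longrightarrow> q ^ i \<noteq> 1" and "j \<le> N"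
  shows "qsum (Suc N) q (inverse q ^ (2 * j)) = (-1) ^ j * inverse q ^ j\<^sup>2"
  using \<open>j \<le> N\<close>
proof (induction j)
  case 0
  show ?case by (simp add: qsum_at_one)
next
  case (Suc j)
  define x where "x = inverse q ^ (2 * Suc j)"
  have xq: "x * q\<^sup>2 = inverse q ^ (2 * j)"
    using \<open>q \<noteq> 0\<close> by (simp add: x_def power2_eq_square power_add field_simps)
  have "qpochhammer (x * q\<^sup>2) (q\<^sup>2) N = 0"
    using qpochhammer_inverse_power_eq_0[of "q\<^sup>2" j N] Suc.prems \<open>q \<noteq> 0\<close>
    by (simp add: xq power_mult power_inverse)
  hence "qsum (Suc N) q x + x * q * qsum (Suc N) q (inverse q ^ (2 * j)) = 0"
    using qsum_functional_equation[OF assms(2), of N x] by (simp add: xq)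
  hence "qsum (Suc N) q x = - (x * q * ((-1) ^ j * inverse q ^ j\<^sup>2))"
    using Suc by (simp add: add_eq_0_iff2)
  also have "x * q = inverse q ^ (2 * j + 1)"
    using \<open>q \<noteq> 0\<close> by (simp add: x_def field_simps)
  also have "- (inverse q ^ (2 * j + 1) * ((-1) ^ j * inverse q ^ j\<^sup>2))
      = (-1) ^ Suc j * inverse q ^ (2 * j + 1 + j\<^sup>2)"
    by (simp only: power_add) simp
  also have "2 * j + 1 + j\<^sup>2 = (Suc j)\<^sup>2"
    by (simp add: power2_eq_square)
  finally show ?case unfolding x_def .
qed

section \<open>The series at a primitive root of unity\<close>

lemma primitive_root_power_eq_1_iff:
  assumes "z \<in> primitive_unity_roots n" "n > 0"
  shows "z ^ a = 1 \<longleftrightarrow> n dvd a"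
proof
  have zn: "z ^ n = 1" using assms(1) by (simp add: primitive_unity_roots_def)
  show "z ^ a = 1" if "n dvd a"
    using that zn by (auto simp: power_mult)
  show "n dvd a" if "z ^ a = 1"
  proof (rule ccontr)
    assume "\<not> n dvd a"
    hence "a mod n > 0" by (simp add: mod_greater_zero_iff_not_dvd)
    moreover have "z ^ (a mod n) = z ^ (n * (a div n) + a mod n)"
      using zn by (simp only: power_add power_mult) simp
    hence "z ^ (a mod n) = 1" using \<open>z ^ a = 1\<close> by simp
    ultimately show False
      using assms by (auto simp: primitive_unity_roots_def)
  qed
qed

text \<open>The dependence on x is made a polynomial because its coefficients and its x-derivative
  are needed at a root of unity.\<close>

definition qsum_poly :: "nat \<Rightarrow> 'a::field \<Rightarrow> 'a poly" where
  "qsum_poly n q = (\<Sum>k<n. smult (q ^ k / qpochhammer q q k) (\<Prod>i<k. [:1, - (q ^ (2 * i)):]))"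

lemma poly_qsum_poly: "poly (qsum_poly n q) x = qsum n q x"
  by (simp add: qsum_poly_def qsum_def poly_sum poly_prod qpochhammer_def mult.commute
      flip: power_mult)

lemma degree_qsum_poly: "degree (qsum_poly (Suc N) q) \<le> N"
  unfolding qsum_poly_def
proof (rule degree_sum_le)
  fix k assume "k \<in> {..<Suc N}"
  have "degree (\<Prod>i<k. [:1, - (q ^ (2 * i)):]) \<le> (\<Sum>i<k. degree [:1, - (q ^ (2 * i)):])"
    using degree_prod_sum_le[of "{..<k}" "\<lambda>i. [:1, - (q ^ (2 * i)):]"] by (simp add: comp_def)
  also have "\<dots> \<le> (\<Sum>i<k. 1)" by (intro sum_mono) simp
  also have "\<dots> \<le> N" using \<open>k \<in> {..<Suc N}\<close> by simp
  finally show "degree (smult (q ^ k / qpochhammer q q k) (\<Prod>i<k. [:1, - (q ^ (2 * i)):])) \<le> N"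
    using degree_smult_le order_trans by blast
qed simp

lemma poly_eq_sum_lessThan:
  fixes p :: "'a::comm_semiring_1 poly"
  assumes "degree p < n"
  shows "poly p x = (\<Sum>i<n. coeff p i * x ^ i)"
  unfolding poly_altdef using assms
  by (intro sum.mono_neutral_left) (auto simp: coeff_eq_0)

locale odd_primitive_root =
  fixes n m :: nat and \<zeta> :: complex
  assumes prim: "\<zeta> \<in> primitive_unity_roots n" and n_eq: "n = 2 * m + 1" and m_pos: "m > 0"
begin

lemma n_Suc: "n = Suc (2 * m)"
  by (simp add: n_eq)

lemma root_power_eq_1_iff: "\<zeta> ^ a = 1 \<longleftrightarrow> n dvd a"
  using primitive_root_power_eq_1_iff[OF prim] by (simp add: n_eq)

lemma root_nonzero: "\<zeta> \<noteq> 0"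
  using root_power_eq_1_iff[of n] by (auto simp: n_eq)

lemma root_power_neq_1: "0 < i \<Longrightarrow> i \<le> 2 * m \<Longrightarrow> \<zeta> ^ i \<noteq> 1"
  unfolding root_power_eq_1_iff by (auto simp: n_eq dest: dvd_imp_le)

lemma qsum_at_root:
  "j \<le> 2 * m \<Longrightarrow> qsum n \<zeta> (inverse \<zeta> ^ (2 * j)) = (-1) ^ j * inverse \<zeta> ^ j\<^sup>2"
  using qsum_at_inverse_power[of \<zeta> "2 * m" j] root_nonzero root_power_neq_1 by (simp add: n_Suc)

lemma inverse_power_eqI:
  assumes "\<zeta> ^ a * \<zeta> ^ b = 1"
  shows "inverse \<zeta> ^ a = \<zeta> ^ b"
  using assms root_nonzero by (simp add: power_inverse field_simps)

text \<open>As n is odd, the square of \<zeta> is again a primitive n-th root of unity. The nodes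
  thus give n interpolation points, enough to identify polynomials of degree below n.\<close>

lemma inj_on_nodes: "inj_on (\<lambda>j. inverse \<zeta> ^ (2 * j)) {..<n}"
proof -
  have "\<not> inverse \<zeta> ^ (2 * j) = inverse \<zeta> ^ (2 * l)" if "j < l" "l < n" for j l
  proof
    assume eq: "inverse \<zeta> ^ (2 * j) = inverse \<zeta> ^ (2 * l)"
    have "\<zeta> ^ (2 * l) = \<zeta> ^ (2 * j) * \<zeta> ^ (2 * (l - j))"
      unfolding power_add[symmetric] using that by (intro arg_cong[of _ _ "(^) \<zeta>"]) auto
    hence "\<zeta> ^ (2 * (l - j)) = 1"
      using eq root_nonzero by (simp add: power_inverse field_simps)
    hence "n dvd 2 * (l - j)" by (simp add: root_power_eq_1_iff)
    moreover have "coprime n 2" by (simp add: n_eq)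
    ultimately have "n dvd l - j" by (simp only: coprime_dvd_mult_right_iff)
    thus False using that by (auto dest: dvd_imp_le)
  qed
  thus ?thesis
    by (intro inj_onI) (metis lessThan_iff nat_neq_iff)
qed

text \<open>
  The coefficient form of \<open>x\<^sup>n\<^sup>-\<^sup>1 F(1/x) = \<zeta> F(\<zeta>\<^sup>2 x)\<close> for \<open>F = qsum n \<zeta>\<close>: both sides are polynomials
  of degree less than \<open>n\<close> in \<open>x\<close>, and they agree at all \<open>n\<close>-th roots of unity \<open>\<zeta>\<^sup>-\<^sup>2\<^sup>j\<close>.
\<close>
lemma coeff_qsum_poly_reflect:
  assumes "i < n"
  shows "coeff (qsum_poly n \<zeta>) (2 * m - i) = \<zeta> ^ (2 * i + 1) * coeff (qsum_poly n \<zeta>) i"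
proof -
  define p where "p = qsum_poly n \<zeta>"
  define L where "L = (\<Sum>i<n. monom (coeff p (2 * m - i)) i)"
  define R where "R = (\<Sum>i<n. monom (\<zeta> ^ (2 * i + 1) * coeff p i) i)"
  define A where "A = (\<lambda>j. inverse \<zeta> ^ (2 * j)) ` {..<n}"
  have deg: "degree p < n"
    using degree_qsum_poly[of "2 * m" \<zeta>] by (simp add: p_def n_Suc)
  have p: "(\<Sum>i<n. coeff p i * x ^ i) = qsum n \<zeta> x" for x
    using poly_eq_sum_lessThan[OF deg, of x] by (simp add: p_def poly_qsum_poly)
  have L: "poly L x = x ^ (2 * m) * qsum n \<zeta> (inverse x)" if "x \<noteq> 0" for x
  proof -
    have "poly L x = (\<Sum>i<n. coeff p (2 * m - i) * x ^ i)"
      by (simp add: L_def poly_sum poly_monom)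
    also have "\<dots> = (\<Sum>i<n. coeff p i * x ^ (2 * m - i))"
      by (rule sum.reindex_bij_witness[of _ "\<lambda>i. 2 * m - i" "\<lambda>i. 2 * m - i"]) (auto simp: n_eq)
    also have "\<dots> = (\<Sum>i<n. x ^ (2 * m) * (coeff p i * inverse x ^ i))"
      using that by (intro sum.cong refl) (simp add: n_eq power_diff power_inverse field_simps)
    finally show ?thesis by (simp only: p flip: sum_distrib_left)
  qed
  have R: "poly R x = \<zeta> * qsum n \<zeta> (\<zeta>\<^sup>2 * x)" for x
    unfolding p[symmetric] R_def
    by (simp add: poly_sum poly_monom sum_distrib_left power_mult_distrib mult_ac del: sum.lessThan_Suc flip: power_mult)
  have "L = R"
  proof (rule poly_eqI_degree)
    show "poly L x = poly R x" if "x \<in> A" for x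
    proof -
      define w where "w = inverse \<zeta>"
      have w: "\<zeta> * w = 1" and wn: "w ^ n = 1" using root_nonzero root_power_eq_1_iff[of n]
        by (simp_all add: w_def power_inverse)
      obtain j where "j < n" and x: "x = w ^ (2 * j)"
        using \<open>x \<in> A\<close> by (auto simp: A_def w_def)
      hence j: "j \<le> 2 * m" by (simp add: n_eq)
      have F: "qsum n \<zeta> (w ^ (2 * i)) = (-1) ^ i * w ^ i\<^sup>2" if "i \<le> 2 * m" for i
        using qsum_at_root[OF that] by (simp add: w_def)
      have root1: "\<zeta> ^ a = 1" if "a = n * b" for a b
        using that by (simp add: root_power_eq_1_iff)
      \<comment> \<open>Trades a negative power of \<zeta> for a nonnegative one: the two exponents
        only have to add up to a multiple of n.\<close>
      have winv: "w ^ a = \<zeta> ^ b" if "a + b = n * c" for a b c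
        unfolding w_def by (rule inverse_power_eqI) (use root1[OF that] in \<open>simp add: power_add\<close>)
      show ?thesis
      \<comment> \<open>At j = 0, that is x = 1, neither n - j nor j - 1 lies in the range 0..2m
        where F is known. There the argument \<zeta>^2 on the right is the node with index
        2m.\<close>
      proof (cases "j = 0")
        case True
        have "w ^ (2 * (2 * m)) = \<zeta>\<^sup>2"
          by (rule winv[of _ _ 2]) (simp add: n_eq)
        hence "qsum n \<zeta> (\<zeta>\<^sup>2) = w ^ (2 * m)\<^sup>2"
          using F[of "2 * m"] by simp
        also have "\<dots> = \<zeta> ^ (2 * m)"
          by (rule winv[of _ _ "2 * m"]) (simp add: n_eq power2_eq_square)
        finally have "\<zeta> * qsum n \<zeta> (\<zeta>\<^sup>2) = 1"
          using root1[of n 1] by (simp add: n_eq)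
        thus ?thesis
          using F[of 0] L[of 1] R[of 1] True x by simp
      next
        case False
        then obtain l where l: "j = Suc l" by (cases j) auto
        have x_nz: "x \<noteq> 0"
          using root_nonzero by (simp add: x w_def)
        have x_inv: "inverse x = \<zeta> ^ (2 * j)"
          using root_nonzero by (simp add: x w_def power_inverse)
        have "x * x ^ (2 * m) = x ^ n"
          by (simp add: n_eq)
        also have "\<dots> = (w ^ n) ^ (2 * j)"
          unfolding x power_mult[symmetric] by (simp only: mult_ac)
        finally have "x ^ (2 * m) = inverse x"
          by (simp add: wn inverse_unique)
        hence x_pow: "x ^ (2 * m) = \<zeta> ^ (2 * j)"
          by (simp only: x_inv)
        \<comment> \<open>The point 1/x is itself the node with index n - j, so F is known
          there.\<close>
        have "w ^ (2 * (n - j)) = \<zeta> ^ (2 * j)"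
          using j by (intro winv[of _ _ 2]) (simp add: n_eq)
        hence "qsum n \<zeta> (inverse x) = (-1) ^ (n - j) * w ^ (n - j)\<^sup>2"
          using F[of "n - j"] False by (simp add: x_inv n_eq)
        \<comment> \<open>Because n is odd, n - j and l = j - 1 have the same parity.\<close>
        also have "(-1) ^ (n - j) = ((-1) ^ l :: complex)"
          using j by (auto simp: n_eq l minus_one_power_iff)
        \<comment> \<open>The inserted factor is 1; it turns the exponent into (n - j)^2 + 2nj = n^2
          + j^2 and so avoids a subtraction.\<close>
        also have "w ^ (n - j)\<^sup>2 = w ^ (n - j)\<^sup>2 * (w ^ n) ^ (2 * j)"
          by (simp add: wn)
        also have "\<dots> = w ^ ((n - j)\<^sup>2 + n * (2 * j))"
          by (simp only: power_add power_mult)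
        also have "(n - j)\<^sup>2 + n * (2 * j) = n * n + j\<^sup>2"
        proof -
          obtain r where "n = j + r" using j by (metis n_Suc le_SucI le_Suc_ex)
          thus ?thesis by (simp add: power2_eq_square algebra_simps)
        qed
        also have "w ^ (n * n + j\<^sup>2) = w ^ j\<^sup>2"
          by (simp add: power_add power_mult wn)
        also have "j\<^sup>2 = l\<^sup>2 + (2 * l + 1)"
          by (simp add: l power2_eq_square)
        finally have "poly L x = \<zeta> ^ (2 * j) * ((-1) ^ l * w ^ (l\<^sup>2 + (2 * l + 1)))"
          by (simp only: L[OF x_nz] x_pow)
        also have "\<dots> = (\<zeta> * w) ^ (2 * l + 1) * (\<zeta> * ((-1) ^ l * w ^ l\<^sup>2))"
          by (simp add: l power_add power_mult_distrib mult_ac)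
        also have "\<dots> = \<zeta> * qsum n \<zeta> (w ^ (2 * l))"
          using F[of l] j by (simp add: w l)
        also have "w ^ (2 * l) = \<zeta>\<^sup>2 * x"
        proof -
          have "\<zeta>\<^sup>2 * x = (\<zeta> * w)\<^sup>2 * w ^ (2 * l)"
            by (simp add: x l power2_eq_square power_mult_distrib)
          thus ?thesis by (simp add: w)
        qed
        finally show ?thesis by (simp add: R)
      qed
    qed
    have "card A = n" unfolding A_def using inj_on_nodes by (subst card_image) auto
    moreover have "degree L < n"
      unfolding L_def by (rule degree_sum_less) (auto simp: n_eq intro: le_less_trans[OF degree_monom_le])
    moreover have "degree R < n"
      unfolding R_def by (rule degree_sum_less) (auto simp: n_eq intro: le_less_trans[OF degree_monom_le])
    ultimately show "degree L < card A" "degree R < card A" by auto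
  qed
  hence "coeff L i = coeff R i" by simp
  thus ?thesis using assms by (simp add: L_def R_def coeff_sum p_def)
qed

text \<open>By \<open>coeff_qsum_poly_reflect\<close> the terms \<open>d i\<close> are symmetric
  under i -> 2m - i. So the sums of i \<open>d i\<close> and of (2m - i) \<open>d i\<close> agree,
  and half of their total is m times the sum of all \<open>d i\<close>.\<close>

lemma pderiv_qsum_poly_root:
  "\<zeta> * poly (pderiv (qsum_poly n \<zeta>)) \<zeta> = of_nat m * qsum n \<zeta> \<zeta>"
proof -
  define p where "p = qsum_poly n \<zeta>"
  define d where "d = (\<lambda>i. coeff p i * \<zeta> ^ i)"
  have deg: "degree p \<le> 2 * m"
    using degree_qsum_poly[of "2 * m" \<zeta>] by (simp add: p_def n_Suc)
  have sym: "d (2 * m - i) = d i" if "i < n" for i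
  proof -
    have "d (2 * m - i) = coeff p i * (\<zeta> ^ (2 * i + 1) * \<zeta> ^ (2 * m - i))"
      using coeff_qsum_poly_reflect[OF that] by (simp add: d_def p_def)
    also have "\<zeta> ^ (2 * i + 1) * \<zeta> ^ (2 * m - i) = \<zeta> ^ n * \<zeta> ^ i"
      unfolding power_add[symmetric] using that by (intro arg_cong[of _ _ "(^) \<zeta>"]) (auto simp: n_eq)
    also have "\<zeta> ^ n = 1" by (simp add: root_power_eq_1_iff)
    finally show ?thesis by (simp add: d_def)
  qed
  have F: "qsum n \<zeta> \<zeta> = (\<Sum>i<n. d i)"
    using poly_eq_sum_lessThan[of p n \<zeta>] deg by (simp add: p_def d_def poly_qsum_poly n_eq)
  have "\<zeta> * poly (pderiv p) \<zeta> = (\<Sum>i<n. of_nat i * d i)"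
  proof -
    have "poly (pderiv p) \<zeta> = (\<Sum>i<2 * m. coeff (pderiv p) i * \<zeta> ^ i)"
      using deg m_pos by (intro poly_eq_sum_lessThan) (simp add: degree_pderiv)
    also have "\<zeta> * \<dots> = (\<Sum>i<2 * m. of_nat (Suc i) * d (Suc i))"
      by (simp add: sum_distrib_left coeff_pderiv d_def mult_ac)
    also have "\<dots> = (\<Sum>i<n. of_nat i * d i)"
      unfolding n_Suc by (subst sum.lessThan_Suc_shift) simp
    finally show ?thesis .
  qed
  moreover have "(\<Sum>i<n. of_nat i * d i) = (\<Sum>i<n. of_nat (2 * m - i) * d i)"
    using sym by (intro sum.reindex_bij_witness[of _ "\<lambda>i. 2 * m - i" "\<lambda>i. 2 * m - i"]) (auto simp: n_eq)
  ultimately have "2 * (\<zeta> * poly (pderiv p) \<zeta>)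
      = (\<Sum>i<n. of_nat i * d i + of_nat (2 * m - i) * d i)"
    by (simp only: sum.distrib) simp
  also have "\<dots> = (\<Sum>i<n. 2 * of_nat m * d i)"
  proof (intro sum.cong refl)
    fix i assume "i \<in> {..<n}"
    hence "i \<le> 2 * m" by (simp add: n_eq)
    hence "of_nat i + of_nat (2 * m - i) = (of_nat (2 * m) :: complex)"
      by (simp flip: of_nat_add)
    thus "of_nat i * d i + of_nat (2 * m - i) * d i = 2 * of_nat m * d i"
      by (simp flip: distrib_right)
  qed
  finally show ?thesis by (simp add: F p_def mult.assoc flip: sum_distrib_left)
qed

end

section \<open>Congruences from double zeros\<close>

text \<open>
  A single fraction \<open>P / Q\<close> must serve on all of \<open>U\<close>, because the numerator has to vanish to second
  order at every primitive root of unity simultaneously.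
\<close>
definition evaluates :: "complex set \<Rightarrow> rat poly fract \<Rightarrow> (complex \<Rightarrow> complex) \<Rightarrow> bool" where
  "evaluates U r f \<longleftrightarrow> (\<exists>P Q. Q \<noteq> 0 \<and> r = Fract P Q \<and>
     (\<forall>z\<in>U. poly (crp Q) z \<noteq> 0 \<and> f z = poly (crp P) z / poly (crp Q) z))"

lemma evaluatesI:
  assumes "Q \<noteq> 0" "r = Fract P Q" "\<And>z. z \<in> U \<Longrightarrow> poly (crp Q) z \<noteq> 0"
    and "\<And>z. z \<in> U \<Longrightarrow> f z = poly (crp P) z / poly (crp Q) z"
  shows "evaluates U r f"
  using assms unfolding evaluates_def by blast

lemma evaluatesE:
  assumes "evaluates U r f"
  obtains P Q where "Q \<noteq> 0" "r = Fract P Q" "\<And>z. z \<in> U \<Longrightarrow> poly (crp Q) z \<noteq> 0"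
    and "\<And>z. z \<in> U \<Longrightarrow> f z = poly (crp P) z / poly (crp Q) z"
  using assms unfolding evaluates_def by blast

section \<open>Arithmetic of evaluations at complex points\<close>

lemma crp_minus: "crp (- p) = - crp p"
  by (simp add: poly_eq_iff coeff_map_poly of_rat_minus)

lemma evaluates_0: "evaluates U 0 (\<lambda>_. 0)"
  by (rule evaluatesI[of 1 _ 0]) (auto simp: Zero_fract_def)

lemma evaluates_1: "evaluates U 1 (\<lambda>_. 1)"
  by (rule evaluatesI[of 1 _ 1]) (auto simp: One_fract_def)

lemma evaluates_qvar: "evaluates U qvar (\<lambda>z. z)"
  by (rule evaluatesI[of 1 _ "[:0, 1:]"]) (auto simp: qvar_def to_fract_def map_poly_pCons)

lemma evaluates_minus:
  assumes "evaluates U r f"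
  shows "evaluates U (- r) (\<lambda>z. - f z)"
proof -
  from assms obtain P Q where *: "Q \<noteq> 0" "r = Fract P Q" "\<And>z. z \<in> U \<Longrightarrow> poly (crp Q) z \<noteq> 0"
    "\<And>z. z \<in> U \<Longrightarrow> f z = poly (crp P) z / poly (crp Q) z" by (rule evaluatesE) blast
  show ?thesis
    by (rule evaluatesI[of Q _ "- P"]) (use * in \<open>auto simp: crp_minus\<close>)
qed

lemma evaluates_add:
  assumes "evaluates U r f" "evaluates U s g"
  shows "evaluates U (r + s) (\<lambda>z. f z + g z)"
proof -
  from assms(1) obtain P Q where 1: "Q \<noteq> 0" "r = Fract P Q" "\<And>z. z \<in> U \<Longrightarrow> poly (crp Q) z \<noteq> 0"
    "\<And>z. z \<in> U \<Longrightarrow> f z = poly (crp P) z / poly (crp Q) z" by (rule evaluatesE) blast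
  from assms(2) obtain P' Q' where 2: "Q' \<noteq> 0" "s = Fract P' Q'" "\<And>z. z \<in> U \<Longrightarrow> poly (crp Q') z \<noteq> 0"
    "\<And>z. z \<in> U \<Longrightarrow> g z = poly (crp P') z / poly (crp Q') z" by (rule evaluatesE) blast
  show ?thesis
    by (rule evaluatesI[of "Q * Q'" _ "P * Q' + P' * Q"])
       (use 1 2 in \<open>auto simp: crp_add crp_mult add_frac_eq\<close>)
qed

lemma evaluates_diff:
  "evaluates U r f \<Longrightarrow> evaluates U s g \<Longrightarrow> evaluates U (r - s) (\<lambda>z. f z - g z)"
  using evaluates_add[OF _ evaluates_minus, of U r f s g] by simp

lemma evaluates_mult:
  assumes "evaluates U r f" "evaluates U s g"
  shows "evaluates U (r * s) (\<lambda>z. f z * g z)"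
proof -
  from assms(1) obtain P Q where 1: "Q \<noteq> 0" "r = Fract P Q" "\<And>z. z \<in> U \<Longrightarrow> poly (crp Q) z \<noteq> 0"
    "\<And>z. z \<in> U \<Longrightarrow> f z = poly (crp P) z / poly (crp Q) z" by (rule evaluatesE) blast
  from assms(2) obtain P' Q' where 2: "Q' \<noteq> 0" "s = Fract P' Q'" "\<And>z. z \<in> U \<Longrightarrow> poly (crp Q') z \<noteq> 0"
    "\<And>z. z \<in> U \<Longrightarrow> g z = poly (crp P') z / poly (crp Q') z" by (rule evaluatesE) blast
  show ?thesis
    by (rule evaluatesI[of "Q * Q'" _ "P * P'"]) (use 1 2 in \<open>auto simp: crp_mult\<close>)
qed

text \<open>A point of \<open>U\<close> shows that the numerator of s is not the zero polynomial, so
  it may serve as part of the new denominator.\<close>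

lemma evaluates_divide:
  assumes "evaluates U r f" "evaluates U s g" "\<And>z. z \<in> U \<Longrightarrow> g z \<noteq> 0" "U \<noteq> {}"
  shows "evaluates U (r / s) (\<lambda>z. f z / g z)"
proof -
  from assms(1) obtain P Q where 1: "Q \<noteq> 0" "r = Fract P Q" "\<And>z. z \<in> U \<Longrightarrow> poly (crp Q) z \<noteq> 0"
    "\<And>z. z \<in> U \<Longrightarrow> f z = poly (crp P) z / poly (crp Q) z" by (rule evaluatesE) blast
  from assms(2) obtain P' Q' where 2: "Q' \<noteq> 0" "s = Fract P' Q'" "\<And>z. z \<in> U \<Longrightarrow> poly (crp Q') z \<noteq> 0"
    "\<And>z. z \<in> U \<Longrightarrow> g z = poly (crp P') z / poly (crp Q') z" by (rule evaluatesE) blast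
  have 3: "poly (crp P') z \<noteq> 0" if "z \<in> U" for z
    using 2(4)[OF that] assms(3)[OF that] by auto
  hence "P' \<noteq> 0" using assms(4) by auto
  with 1 2 3 show ?thesis
    by (intro evaluatesI[of "Q * P'" _ "P * Q'"]) (auto simp: crp_mult)
qed

lemma evaluates_power: "evaluates U r f \<Longrightarrow> evaluates U (r ^ k) (\<lambda>z. f z ^ k)"
  by (induction k) (auto intro: evaluates_1 evaluates_mult)

lemma evaluates_sum:
  "(\<And>i. i \<in> A \<Longrightarrow> evaluates U (r i) (f i)) \<Longrightarrow> evaluates U (\<Sum>i\<in>A. r i) (\<lambda>z. \<Sum>i\<in>A. f i z)"
  by (induction A rule: infinite_finite_induct) (auto intro: evaluates_0 evaluates_add)

lemma evaluates_prod:
  "(\<And>i. i \<in> A \<Longrightarrow> evaluates U (r i) (f i)) \<Longrightarrow> evaluates U (\<Prod>i\<in>A. r i) (\<lambda>z. \<Prod>i\<in>A. f i z)"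
  by (induction A rule: infinite_finite_induct) (auto intro: evaluates_1 evaluates_mult)

lemmas evaluates_intros = evaluates_1 evaluates_qvar evaluates_minus evaluates_add evaluates_diff
  evaluates_mult evaluates_divide evaluates_power evaluates_sum evaluates_prod

lemma evaluates_qpochhammer:
  "evaluates U r f \<Longrightarrow> evaluates U s g \<Longrightarrow>
   evaluates U (qpochhammer r s k) (\<lambda>z. qpochhammer (f z) (g z) k)"
  unfolding qpochhammer_def by (intro evaluates_intros)

lemma evaluates_qint: "evaluates U r f \<Longrightarrow> evaluates U (qint r n) (\<lambda>z. qint (f z) n)"
  unfolding qint_def by (intro evaluates_intros)

text \<open>The analytic counterpart of divisibility by (q - z)^2. It applies directly to rational
  expressions, without bringing them to a common denominator.\<close>

definition double_zero :: "(complex \<Rightarrow> complex) \<Rightarrow> complex \<Rightarrow> bool" where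
  "double_zero f z \<longleftrightarrow> f z = 0 \<and> (f has_field_derivative 0) (at z)"

lemma double_zero_diff: "double_zero f z \<Longrightarrow> double_zero g z \<Longrightarrow> double_zero (\<lambda>w. f w - g w) z"
  unfolding double_zero_def by (auto intro!: derivative_eq_intros)

lemma double_zero_mult:
  "(g has_field_derivative D) (at z) \<Longrightarrow> double_zero f z \<Longrightarrow> double_zero (\<lambda>w. g w * f w) z"
  unfolding double_zero_def by (auto intro!: derivative_eq_intros)

lemma double_zero_mult_zeros:
  "(f has_field_derivative D) (at z) \<Longrightarrow> (g has_field_derivative E) (at z) \<Longrightarrow>
    f z = 0 \<Longrightarrow> g z = 0 \<Longrightarrow> double_zero (\<lambda>w. f w * g w) z"
  unfolding double_zero_def by (auto intro!: derivative_eq_intros)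

text \<open>Value and derivative depend only on the behaviour near z, so identities that hold away
  from the poles are enough.\<close>

lemma double_zero_cong:
  assumes "double_zero f z" "open U" "z \<in> U" "\<And>w. w \<in> U \<Longrightarrow> f w = g w"
  shows "double_zero g z"
proof -
  have "eventually (\<lambda>w. f w = g w) (nhds z)"
    using eventually_nhds_in_open[OF assms(2,3)] by eventually_elim (use assms(4) in auto)
  from DERIV_cong_ev[OF refl this refl] assms show ?thesis
    unfolding double_zero_def by auto
qed

text \<open>Writing p = (X - z) s, the derivative of p at z is s(z); its vanishing yields the second
  linear factor.\<close>

lemma double_zero_poly_dvd:
  assumes "double_zero (poly p) z"
  shows "[:- z, 1:]\<^sup>2 dvd p"
proof -
  from assms have 0: "poly p z = 0" "(poly p has_field_derivative 0) (at z)"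
    by (auto simp: double_zero_def)
  have d: "poly (pderiv p) z = 0"
    by (rule DERIV_unique[OF poly_DERIV 0(2)])
  from 0(1) obtain s where s: "p = [:- z, 1:] * s"
    by (auto simp: poly_eq_0_iff_dvd)
  from d have "poly s z = 0"
    unfolding s pderiv_mult by (simp add: pderiv_pCons)
  thus ?thesis
    unfolding s power2_eq_square poly_eq_0_iff_dvd by (intro mult_dvd_mono dvd_refl)
qed

text \<open>The product over \<open>A\<close> does not vanish at a new point b, so the whole order
  of p at b passes to the cofactor q.\<close>

lemma prod_linear_squares_dvd:
  fixes p :: "complex poly"
  assumes "finite A" "\<And>a. a \<in> A \<Longrightarrow> [:- a, 1:]\<^sup>2 dvd p"
  shows "(\<Prod>a\<in>A. [:- a, 1:])\<^sup>2 dvd p"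
proof (cases "p = 0")
  case False
  from assms show ?thesis
  proof (induction A rule: finite_induct)
    case (insert b A)
    then obtain q where q: "p = (\<Prod>a\<in>A. [:- a, 1:])\<^sup>2 * q" by (auto elim: dvdE)
    have nz: "q \<noteq> 0" "(\<Prod>a\<in>A. [:- a, 1:])\<^sup>2 \<noteq> 0" using False q by auto
    have "poly ((\<Prod>a\<in>A. [:- a, 1:])\<^sup>2) b \<noteq> 0"
      using insert.hyps by (auto simp: poly_prod)
    hence "order b p = order b q"
      using False by (simp add: q order_mult order_0I)
    moreover have "2 \<le> order b p"
      using insert.prems False by (auto simp: order_divides)
    ultimately have "[:- b, 1:]\<^sup>2 dvd q" by (simp add: order_divides)
    hence "(\<Prod>a\<in>A. [:- a, 1:])\<^sup>2 * [:- b, 1:]\<^sup>2 dvd p" unfolding q by (intro mult_dvd_mono) auto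
    thus ?case
      unfolding prod.insert[OF insert.hyps] power_mult_distrib by (simp only: mult.commute)
  qed simp
qed simp

text \<open>A complex zero of a common divisor would be a primitive n-th root of unity at which Q
  vanishes. By the fundamental theorem of algebra a polynomial without complex zeros is
  constant.\<close>

lemma coprime_cyclotomicI:
  assumes "n > 0" "Q \<noteq> 0" "\<And>z. z \<in> primitive_unity_roots n \<Longrightarrow> poly (crp Q) z \<noteq> 0"
  shows "coprime Q (cyclotomic n)"
proof (rule coprimeI)
  fix c assume "c dvd Q" "c dvd cyclotomic n"
  then obtain s t where s: "Q = c * s" and t: "cyclotomic n = c * t" by (auto elim!: dvdE)
  have "poly (crp c) z \<noteq> 0" for z
  proof
    assume 0: "poly (crp c) z = 0"
    have "(\<Prod>a\<in>primitive_unity_roots n. poly [:- a, 1:] z) = 0"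
      using arg_cong[OF map_poly_cyclotomic[OF assms(1)], of "\<lambda>p. poly p z"] 0
      by (simp add: t crp_mult poly_prod)
    hence "z \<in> primitive_unity_roots n"
      using finite_primitive_unity_roots[OF assms(1)] by auto
    moreover have "poly (crp Q) z = 0" using 0 by (simp add: s crp_mult)
    ultimately show False using assms(3) by blast
  qed
  hence "constant (poly (crp c))"
    using fundamental_theorem_of_algebra by blast
  hence "degree c = 0" by (simp add: constant_degree crp_degree)
  moreover have "c \<noteq> 0" using assms(2) s by auto
  ultimately show "is_unit c" by (simp add: is_unit_iff_degree)
qed

text \<open>The bridge from analysis to the congruence: on \<open>U\<close> the product of f with
  the denominator Q is the numerator P, so P inherits the double zeros at all primitive n-th roots
  of unity. Q has no zeros there and is therefore coprime to the cyclotomic polynomial.\<close>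

lemma cong_mod_squareI:
  assumes "n > 0" "evaluates U (A - B) f" "open U" "primitive_unity_roots n \<subseteq> U"
    and dz: "\<And>z. z \<in> primitive_unity_roots n \<Longrightarrow> double_zero f z"
  shows "cong_mod_square (cyclotomic n) A B"
proof -
  from assms(2) obtain P Q where Q: "Q \<noteq> 0" "A - B = Fract P Q"
    "\<And>z. z \<in> U \<Longrightarrow> poly (crp Q) z \<noteq> 0"
    and f: "\<And>z. z \<in> U \<Longrightarrow> f z = poly (crp P) z / poly (crp Q) z" by (rule evaluatesE) blast
  have "(\<Prod>a\<in>primitive_unity_roots n. [:- a, 1:])\<^sup>2 dvd crp P"
  proof (intro prod_linear_squares_dvd double_zero_poly_dvd finite_primitive_unity_roots assms(1))
    fix z assume z: "z \<in> primitive_unity_roots n"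
    have "double_zero (\<lambda>w. poly (crp Q) w * f w) z"
      by (rule double_zero_mult[OF poly_DERIV dz[OF z]])
    thus "double_zero (poly (crp P)) z"
      by (rule double_zero_cong[OF _ assms(3)]) (use z assms(4) Q(3) f in auto)
  qed
  then obtain c where "crp P = (crp (cyclotomic n))\<^sup>2 * c"
    by (auto simp: map_poly_cyclotomic[OF assms(1)] elim: dvdE)
  hence c: "crp P = crp ((cyclotomic n)\<^sup>2) * c"
    by (simp add: crp_mult power2_eq_square)
  have "crp (cyclotomic n) \<noteq> 0"
    unfolding map_poly_cyclotomic[OF assms(1)] by (simp add: finite_primitive_unity_roots assms(1))
  hence "(cyclotomic n)\<^sup>2 \<noteq> 0" by auto
  \<comment> \<open>So far the divisibility is over the complex numbers; division with remainder
    shows that the quotient has rational coefficients.\<close>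
  from crp_dvd_quotient[OF c this] obtain a where "crp P = crp ((cyclotomic n)\<^sup>2 * a)"
    using c by (auto simp: crp_mult)
  hence "P = (cyclotomic n)\<^sup>2 * a" by (simp only: crp_inject)
  moreover have "coprime Q (cyclotomic n)"
    using assms(1,4) Q by (intro coprime_cyclotomicI) auto
  ultimately show ?thesis
    using Q unfolding cong_mod_square_def by (metis dvd_triv_left)
qed

section \<open>Derivatives in the base\<close>

text \<open>Product rule. For i = 0 the truncated exponent i - 1 does no harm, since the factor
  \<open>of_nat i\<close> vanishes.\<close>

lemma DERIV_qpochhammer:
  fixes z :: "'a::real_normed_field"
  assumes "(f has_field_derivative D) (at z)" "(g has_field_derivative E) (at z)"
  shows "((\<lambda>w. qpochhammer (f w) (g w) k) has_field_derivative
    (\<Sum>i<k. - (D * g z ^ i + f z * (of_nat i * g z ^ (i - 1) * E)) *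
      (\<Prod>j\<in>{..<k} - {i}. 1 - f z * g z ^ j))) (at z)"
  unfolding qpochhammer_def
  by (rule has_field_derivative_prod) (auto intro!: derivative_eq_intros assms simp: mult_ac)

text \<open>Both arguments agree at z, so the contributions of the varying base cancel and only the
  x-derivative, weighted by D - E, remains. The derivative of F in its base never has to be
  computed.\<close>

lemma DERIV_qpochhammer_diff:
  fixes z :: "'a::real_normed_field"
  assumes "(f has_field_derivative D) (at z)" "(g has_field_derivative E) (at z)" "f z = g z"
  shows "((\<lambda>w. qpochhammer (f w) (w\<^sup>2) k - qpochhammer (g w) (w\<^sup>2) k) has_field_derivative
    (D - E) * poly (pderiv (\<Prod>i<k. [:1, - (z ^ (2 * i)):])) (f z)) (at z)"
proof -
  have sq: "((\<lambda>w. w\<^sup>2) has_field_derivative 2 * z) (at z)"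
    by (auto intro!: derivative_eq_intros)
  define R where "R = (\<lambda>i. \<Prod>j\<in>{..<k} - {i}. 1 - f z * (z\<^sup>2) ^ j)"
  have "poly (pderiv (\<Prod>i<k. [:1, - (z ^ (2 * i)):])) (f z) = (\<Sum>i<k. - ((z\<^sup>2) ^ i * R i))"
    by (simp add: pderiv_prod poly_sum poly_prod pderiv_pCons R_def mult_ac
      flip: power_mult)
  hence "(D - E) * poly (pderiv (\<Prod>i<k. [:1, - (z ^ (2 * i)):])) (f z)
      = (\<Sum>i<k. - (D * (z\<^sup>2) ^ i + f z * (of_nat i * (z\<^sup>2) ^ (i - 1) * (2 * z))) * R i)
      - (\<Sum>i<k. - (E * (z\<^sup>2) ^ i + f z * (of_nat i * (z\<^sup>2) ^ (i - 1) * (2 * z))) * R i)"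
    unfolding sum_subtractf[symmetric]
    by (simp add: sum_distrib_left algebra_simps)
  thus ?thesis
    using DERIV_diff[OF DERIV_qpochhammer[OF assms(1) sq, of k] DERIV_qpochhammer[OF assms(2) sq, of k]]
    by (simp only: R_def assms(3))
qed

lemma DERIV_qsum_diff:
  fixes z :: "'a::real_normed_field"
  assumes f: "(f has_field_derivative D) (at z)" and g: "(g has_field_derivative E) (at z)"
    and fg: "f z = g z" and nz: "\<And>i. 0 < i \<Longrightarrow> i < n \<Longrightarrow> z ^ i \<noteq> 1"
  shows "((\<lambda>w. qsum n w (f w) - qsum n w (g w)) has_field_derivative
    (D - E) * poly (pderiv (qsum_poly n z)) (f z)) (at z)"
proof -
  define r where "r = (\<lambda>k. poly (pderiv (\<Prod>i<k. [:1, - (z ^ (2 * i)):])) (f z))"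
  have "((\<lambda>w. (qpochhammer (f w) (w\<^sup>2) k - qpochhammer (g w) (w\<^sup>2) k) * (w ^ k / qpochhammer w w k))
      has_field_derivative (D - E) * r k * (z ^ k / qpochhammer z z k)) (at z)" if "k < n" for k
  proof -
    have "qpochhammer z z k \<noteq> 0"
      using nz that by (intro qpochhammer_self_nonzero) auto
    \<comment> \<open>The value C drops out: in the product rule it multiplies the difference of the
      two q-Pochhammer symbols, which is 0 at z.\<close>
    then obtain C where "((\<lambda>w. w ^ k / qpochhammer w w k) has_field_derivative C) (at z)"
      using DERIV_divide[OF DERIV_power[OF DERIV_ident] DERIV_qpochhammer[OF DERIV_ident DERIV_ident]]
      by blast
    from DERIV_mult[OF DERIV_qpochhammer_diff[OF f g fg] this] show ?thesis
      using fg by (simp add: r_def)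
  qed
  hence "((\<lambda>w. \<Sum>k<n. (qpochhammer (f w) (w\<^sup>2) k - qpochhammer (g w) (w\<^sup>2) k) *
      (w ^ k / qpochhammer w w k)) has_field_derivative
      (\<Sum>k<n. (D - E) * r k * (z ^ k / qpochhammer z z k))) (at z)"
    by (intro DERIV_sum) auto
  moreover have "(\<Sum>k<n. (D - E) * r k * (z ^ k / qpochhammer z z k))
      = (D - E) * poly (pderiv (qsum_poly n z)) (f z)"
    by (simp add: qsum_poly_def higher_pderiv_sum[of 1, simplified] poly_sum pderiv_smult sum_distrib_left r_def mult_ac)
  moreover have "(\<lambda>w. \<Sum>k<n. (qpochhammer (f w) (w\<^sup>2) k - qpochhammer (g w) (w\<^sup>2) k) *
      (w ^ k / qpochhammer w w k)) = (\<lambda>w. qsum n w (f w) - qsum n w (g w))"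
    by (simp add: qsum_def left_diff_distrib diff_divide_distrib sum_subtractf)
  ultimately show ?thesis by simp
qed

text \<open>The points where z and all denominators (z;z)_k with k < n are nonzero. The set is open
  and contains every primitive n-th root of unity, so it serves as the set \<open>U\<close> of
  \<open>cong_mod_squareI\<close>.\<close>

definition punctured :: "nat \<Rightarrow> complex set" where
  "punctured n = {z. z \<noteq> 0 \<and> (\<forall>i\<in>{0<..<n}. z ^ i \<noteq> 1)}"

lemma punctured_nonzero: "z \<in> punctured n \<Longrightarrow> z \<noteq> 0"
  by (simp add: punctured_def)

lemma punctured_power_neq_1: "z \<in> punctured n \<Longrightarrow> 0 < i \<Longrightarrow> i < n \<Longrightarrow> z ^ i \<noteq> 1"
  by (simp add: punctured_def)

lemma punctured_nonempty: "punctured n \<noteq> {}"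
proof -
  have "(2 :: complex) ^ i \<noteq> 1" if "0 < i" for i
  proof
    assume "(2 :: complex) ^ i = 1"
    hence "norm ((2 :: complex) ^ i) = 1" by simp
    hence "(2 :: real) ^ i = 1" by (simp add: norm_power)
    thus False using one_less_power[of "2 :: real" i] that by simp
  qed
  hence "2 \<in> punctured n" by (auto simp: punctured_def)
  thus ?thesis by blast
qed

lemma open_punctured: "open (punctured n)"
proof -
  have "punctured n = {z. z \<noteq> 0} \<inter> (\<Inter>i\<in>{0<..<n}. {z. z ^ i \<noteq> 1})"
    by (auto simp: punctured_def)
  thus ?thesis
    by (auto intro!: open_Int open_INT open_Collect_neq continuous_intros)
qed

lemma primitive_unity_roots_punctured: "n > 0 \<Longrightarrow> primitive_unity_roots n \<subseteq> punctured n"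
  by (auto simp: primitive_unity_roots_def punctured_def power_0_left)

section \<open>Second-order behaviour at a primitive root of unity\<close>

context odd_primitive_root
begin

lemma root_punctured: "\<zeta> \<in> punctured n"
  using primitive_unity_roots_punctured[of n] prim by (auto simp: n_eq)

lemma root_power_n: "\<zeta> ^ n = 1"
  by (simp add: root_power_eq_1_iff)

text \<open>
  \<open>qsum n z (z powi (1 - n))\<close> is known exactly, and \<open>z powi (1 - n)\<close> differs from \<open>z\<close> only to first
  order at \<open>\<zeta>\<close>; the first-order change is governed by \<open>pderiv_qsum_poly_root\<close>.
\<close>
lemma qsum_diagonal:
  "double_zero (\<lambda>z. qsum n z z - (-1) ^ m * z ^ (m * (m + 1))) \<zeta>"
proof -
  define w where "w = inverse \<zeta>"
  define \<epsilon> where "\<epsilon> = ((-1) ^ m :: complex)"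
  \<comment> \<open>The value of F at z^(-2m) is subtracted and added back in closed form, splitting
    the claim into a difference of F at two arguments that meet at \<zeta> and a difference of
    monomials.\<close>
  define a where "a = (\<lambda>z. (qsum n z z - qsum n z (inverse z ^ (2 * m)))
    + \<epsilon> * (inverse z ^ m\<^sup>2 - z ^ (m * (m + 1))))"
  have w: "\<zeta> * w = 1" using root_nonzero by (simp add: w_def)
  have wn: "w ^ n = 1" using root_power_n by (simp add: w_def power_inverse)
  have w2m: "w ^ (2 * m) = \<zeta>"
    unfolding w_def using root_power_n inverse_power_eqI[of "2 * m" 1]
    by (simp add: n_eq mult.commute)
  have wm2: "w ^ m\<^sup>2 = \<zeta> ^ (m * (m + 1))"
    unfolding w_def
  proof (rule inverse_power_eqI)
    have "m\<^sup>2 + m * (m + 1) = n * m" by (simp add: n_eq power2_eq_square)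
    thus "\<zeta> ^ m\<^sup>2 * \<zeta> ^ (m * (m + 1)) = 1"
      unfolding power_add[symmetric] by (simp add: root_power_eq_1_iff)
  qed
  have eq: "a z = qsum n z z - (-1) ^ m * z ^ (m * (m + 1))" if "z \<in> punctured n" for z
  proof -
    have "qsum n z (inverse z ^ (2 * m)) = \<epsilon> * inverse z ^ m\<^sup>2"
      using qsum_at_inverse_power[of z "2 * m" m] punctured_nonzero[OF that]
        punctured_power_neq_1[OF that] by (simp add: n_Suc \<epsilon>_def)
    thus ?thesis by (simp add: a_def \<epsilon>_def algebra_simps)
  qed
  have "((\<lambda>z. inverse z ^ (2 * m)) has_field_derivative - (2 * of_nat m)) (at \<zeta>)"
  proof -
    have "((\<lambda>z. inverse z ^ (2 * m)) has_field_derivative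
        of_nat (2 * m) * (- (w\<^sup>2) * w ^ (2 * m - 1))) (at \<zeta>)"
      using root_nonzero by (auto intro!: derivative_eq_intros simp: w_def power2_eq_square)
    moreover have "w\<^sup>2 * w ^ (2 * m - 1) = w ^ n"
      unfolding power_add[symmetric] using m_pos by (simp add: n_eq)
    ultimately show ?thesis by (simp add: wn)
  qed
  hence "((\<lambda>z. qsum n z z - qsum n z (inverse z ^ (2 * m))) has_field_derivative
      (1 - - (2 * of_nat m)) * poly (pderiv (qsum_poly n \<zeta>)) \<zeta>) (at \<zeta>)"
    using w2m punctured_power_neq_1[OF root_punctured]
    by (intro DERIV_qsum_diff[OF DERIV_ident]) (auto simp: w_def)
  moreover have "((\<lambda>z. \<epsilon> * (inverse z ^ m\<^sup>2 - z ^ (m * (m + 1)))) has_field_derivative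
      \<epsilon> * (- (of_nat (m\<^sup>2) * w ^ (m\<^sup>2 + 1)) - of_nat (m * (m + 1)) * \<zeta> ^ (m * (m + 1) - 1))) (at \<zeta>)"
  proof -
    have "w ^ (m\<^sup>2 + 1) = w\<^sup>2 * w ^ (m\<^sup>2 - 1)"
      unfolding power_add[symmetric] using m_pos by (intro arg_cong[of _ _ "(^) w"]) auto
    thus ?thesis using root_nonzero
      by (auto intro!: derivative_eq_intros simp: w_def power2_eq_square)
  qed
  ultimately have deriv: "(a has_field_derivative
      ((1 - - (2 * of_nat m)) * poly (pderiv (qsum_poly n \<zeta>)) \<zeta>
      + \<epsilon> * (- (of_nat (m\<^sup>2) * w ^ (m\<^sup>2 + 1)) - of_nat (m * (m + 1)) * \<zeta> ^ (m * (m + 1) - 1)))) (at \<zeta>)"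
    (is "(a has_field_derivative ?D) _")
    unfolding a_def by (rule DERIV_add)
  have val: "qsum n \<zeta> \<zeta> = \<epsilon> * w ^ m\<^sup>2"
    using qsum_at_root[of m] w2m by (simp add: w_def \<epsilon>_def)
  \<comment> \<open>Multiplying the derivative by \<zeta> turns every power in it into the same
    \<open>w ^ m\<^sup>2\<close>.\<close>
  have "\<zeta> * \<zeta> ^ (m * (m + 1) - 1) = w ^ m\<^sup>2"
    unfolding wm2 power_Suc[symmetric] using m_pos by (intro arg_cong[of _ _ "(^) \<zeta>"]) auto
  moreover have "\<zeta> * w ^ (m\<^sup>2 + 1) = w ^ m\<^sup>2"
    using w by (simp add: mult.assoc[symmetric])
  moreover have "\<zeta> * (a * p + \<epsilon> * (- (b * x) - c * y))
      = a * (\<zeta> * p) + \<epsilon> * (- (b * (\<zeta> * x)) - c * (\<zeta> * y))" for a b c p x y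
    by (simp add: algebra_simps)
  ultimately have "\<zeta> * ?D = (1 + 2 * of_nat m) * (\<zeta> * poly (pderiv (qsum_poly n \<zeta>)) \<zeta>)
      + \<epsilon> * (- (of_nat (m\<^sup>2) * w ^ m\<^sup>2) - of_nat (m * (m + 1)) * w ^ m\<^sup>2)"
    by (simp only: diff_minus_eq_add)
  \<comment> \<open>The coefficients cancel: (1 + 2m) m - m^2 - m (m + 1) = 0.\<close>
  also have "\<dots> = 0"
    unfolding pderiv_qsum_poly_root val by (simp add: algebra_simps power2_eq_square)
  finally have "?D = 0" using root_nonzero by simp
  moreover have "a \<zeta> = 0"
    using eq[OF root_punctured] val wm2 by (simp add: \<epsilon>_def)
  ultimately have "double_zero a \<zeta>"
    using deriv unfolding double_zero_def by metis
  thus ?thesis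
    by (rule double_zero_cong[OF _ open_punctured root_punctured eq])
qed

text \<open>Modulo n the odd exponents 2i + 1 with i < n and i different from m run once through the
  nonzero residues: the odd ones for i < m, the even ones 2(i - m) for i > m. In the proof
  \<open>h i + 1\<close> is this residue.\<close>

lemma prod_odd_powers_root:
  "(\<Prod>i\<in>{..<n} - {m}. 1 - \<zeta> * (\<zeta>\<^sup>2) ^ i) = qpochhammer \<zeta> \<zeta> (2 * m)"
proof -
  define h where "h = (\<lambda>i. if i < m then 2 * i else 2 * i - 2 * m - 1)"
  define h' where "h' = (\<lambda>j. if even j then j div 2 else (j + 2 * m + 1) div 2)"
  have "(\<Prod>i\<in>{..<n} - {m}. 1 - \<zeta> * (\<zeta>\<^sup>2) ^ i) = (\<Prod>j<2 * m. 1 - \<zeta> * \<zeta> ^ j)"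
  proof (rule prod.reindex_bij_witness[of _ h' h])
    fix i assume i: "i \<in> {..<n} - {m}"
    show "h' (h i) = i" "h i \<in> {..<2 * m}"
      using i by (auto simp: h_def h'_def n_eq)
    have "\<zeta> ^ (2 * i + 1) = \<zeta> ^ (h i + 1)"
    proof (cases "i < m")
      case False
      with i have "2 * i + 1 = n + (h i + 1)" by (auto simp: h_def n_eq)
      thus ?thesis by (simp only: power_add root_power_n) simp
    qed (simp add: h_def)
    thus "1 - \<zeta> * \<zeta> ^ h i = 1 - \<zeta> * (\<zeta>\<^sup>2) ^ i"
      by (auto simp: power_mult)
  next
    fix j assume j: "j \<in> {..<2 * m}"
    show "h (h' j) = j" "h' j \<in> {..<n} - {m}"
      using j by (auto simp: h_def h'_def n_eq elim!: evenE oddE)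
  qed
  thus ?thesis by (simp add: qpochhammer_def)
qed

text \<open>The factor with i = m is 1 - z^n, and by \<open>prod_odd_powers_root\<close> the
  quotient of the other factors by (z;z)_(2m) is 1 at \<zeta>. The difference is thus a product of
  two functions vanishing at \<zeta>.\<close>

lemma qpochhammer_square_full:
  "double_zero (\<lambda>z. qpochhammer z (z\<^sup>2) n / qpochhammer z z (2 * m) - (1 - z ^ n)) \<zeta>"
proof -
  define \<gamma> where "\<gamma> = (\<lambda>z::complex. (\<Prod>i\<in>{..<n} - {m}. 1 - z * (z\<^sup>2) ^ i) / qpochhammer z z (2 * m) - 1)"
  have eq: "qpochhammer z (z\<^sup>2) n / qpochhammer z z (2 * m) - (1 - z ^ n) = (1 - z ^ n) * \<gamma> z" for z
  proof -
    have "qpochhammer z (z\<^sup>2) n = (1 - z * (z\<^sup>2) ^ m) * (\<Prod>i\<in>{..<n} - {m}. 1 - z * (z\<^sup>2) ^ i)"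
      unfolding qpochhammer_def by (rule prod.remove) (auto simp: n_eq)
    also have "z * (z\<^sup>2) ^ m = z ^ n" by (simp add: n_eq power_mult)
    finally show ?thesis by (simp add: \<gamma>_def algebra_simps)
  qed
  have nz: "qpochhammer \<zeta> \<zeta> (2 * m) \<noteq> 0"
    using root_power_neq_1 by (intro qpochhammer_self_nonzero) auto
  have "((\<lambda>z. \<Prod>i\<in>{..<n} - {m}. 1 - z * (z\<^sup>2) ^ i) has_field_derivative
      (\<Sum>i\<in>{..<n} - {m}. - (\<zeta> * (of_nat i * (2 * \<zeta> * (\<zeta>\<^sup>2) ^ (i - 1))) + (\<zeta>\<^sup>2) ^ i)
        * (\<Prod>j\<in>{..<n} - {m} - {i}. 1 - \<zeta> * (\<zeta>\<^sup>2) ^ j))) (at \<zeta>)"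
    by (rule has_field_derivative_prod) (auto intro!: derivative_eq_intros)
  from DERIV_diff[OF DERIV_divide[OF this DERIV_qpochhammer[OF DERIV_ident DERIV_ident] nz] DERIV_const]
  obtain C where "(\<gamma> has_field_derivative C) (at \<zeta>)" unfolding \<gamma>_def by blast
  moreover have "((\<lambda>z. 1 - z ^ n) has_field_derivative - (of_nat n * \<zeta> ^ (n - 1))) (at \<zeta>)"
    by (auto intro!: derivative_eq_intros)
  moreover have "\<gamma> \<zeta> = 0" using nz by (simp add: \<gamma>_def prod_odd_powers_root)
  ultimately show ?thesis
    unfolding eq by (intro double_zero_mult_zeros) (auto simp: root_power_n)
qed

end

section \<open>The two congruences\<close>

lemma qint_eq: "(1 - q) * qint q n = (1 - q ^ n :: 'a::comm_ring_1)"
  by (simp add: qint_def one_diff_power_eq)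

text \<open>By \<open>qsum_q2_telescope\<close> at x = z, z times the sum is F(z, z) minus the full
  product. The errors \<open>u\<close> and \<open>v\<close> in replacing these by (-1)^m z^(m(m+1))
  and by 1 - z^n = (1 - z) [n] have double zeros.\<close>

lemma qsum_q2_cong:
  fixes n m :: nat
  assumes n: "n = 2 * m + 1" and m: "m > 0"
  shows "cong_mod_square (cyclotomic n)
    (\<Sum>k<n. qpochhammer qvar (qvar\<^sup>2) k / qpochhammer qvar qvar k * qvar ^ (2 * k))
    ((-1) ^ m * qvar ^ (m * (m + 1) - 1) + (qvar - 1) / qvar * qint qvar n)"
    (is "cong_mod_square _ ?A ?B")
proof -
  define f where "f = (\<lambda>z::complex.
    (\<Sum>k<n. qpochhammer z (z\<^sup>2) k / qpochhammer z z k * z ^ (2 * k)) -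
    ((-1) ^ m * z ^ (m * (m + 1) - 1) + (z - 1) / z * qint z n))"
  define u where "u = (\<lambda>z::complex. qsum n z z - (-1) ^ m * z ^ (m * (m + 1)))"
  define v where "v = (\<lambda>z::complex. qpochhammer z (z\<^sup>2) n / qpochhammer z z (2 * m) - (1 - z ^ n))"
  have U: "primitive_unity_roots n \<subseteq> punctured n" "punctured n \<noteq> {}"
    using primitive_unity_roots_punctured[of n] punctured_nonempty[of n] by (simp_all add: n)
  have nz: "qpochhammer z z k \<noteq> 0" if "z \<in> punctured n" "k < n" for z k
    using punctured_power_neq_1[OF that(1)] that(2) by (intro qpochhammer_self_nonzero) auto
  have ev: "evaluates (punctured n) (?A - ?B) f"
    unfolding f_def using nz U punctured_nonzero
    by (intro evaluates_intros evaluates_qpochhammer evaluates_qint) auto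
  have f: "inverse z * (u z - v z) = f z" if "z \<in> punctured n" for z
  proof -
    have z: "z \<noteq> 0" using punctured_nonzero[OF that] .
    have 0: "z * ((z - 1) / z * qint z n) = (z - 1) * qint z n" using z by simp
    have 1: "z * (\<Sum>k<n. qpochhammer z (z\<^sup>2) k / qpochhammer z z k * z ^ (2 * k))
        = qsum n z z - qpochhammer z (z\<^sup>2) n / qpochhammer z z (2 * m)"
      using qsum_q2_telescope[of "2 * m" z z] punctured_power_neq_1[OF that] by (simp add: n)
    have 2: "z * z ^ (m * (m + 1) - 1) = z ^ (m * (m + 1))"
      unfolding power_Suc[symmetric] using m by (intro arg_cong[of _ _ "(^) z"]) auto
    have "z * f z = z * (\<Sum>k<n. qpochhammer z (z\<^sup>2) k / qpochhammer z z k * z ^ (2 * k))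
        - (-1) ^ m * (z * z ^ (m * (m + 1) - 1)) + (1 - z) * qint z n"
      unfolding f_def right_diff_distrib distrib_left[of z] 0 by (simp add: algebra_simps)
    also have "\<dots> = u z - v z"
      unfolding 1 2 qint_eq u_def v_def by simp
    finally show ?thesis using z by (simp add: field_simps)
  qed
  show ?thesis
  proof (rule cong_mod_squareI[OF _ ev open_punctured U(1)])
    fix \<zeta> assume \<zeta>: "\<zeta> \<in> primitive_unity_roots n"
    interpret odd_primitive_root n m \<zeta> by unfold_locales (use n m \<zeta> in auto)
    have uv: "double_zero u \<zeta>" "double_zero v \<zeta>"
      unfolding u_def v_def by (rule qsum_diagonal qpochhammer_square_full)+
    have "double_zero (\<lambda>z. inverse z * (u z - v z)) \<zeta>"
      using root_nonzero uv by (intro double_zero_mult[OF DERIV_inverse] double_zero_diff)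
    thus "double_zero f \<zeta>"
      by (rule double_zero_cong[OF _ open_punctured root_punctured f])
  qed (use n in auto)
qed

text \<open>The functional equation at x = z expresses z^2 F(z, z^3) through F(z, z) and
  (z^3;z^2)_(2m) = (z;z^2)_n / (1 - z), which are controlled by \<open>u\<close> and
  \<open>v\<close>.\<close>

lemma qsum_cube_cong:
  fixes n m :: nat
  assumes n: "n = 2 * m + 1" and m: "m > 0"
  shows "cong_mod_square (cyclotomic n)
    (\<Sum>k<n. qpochhammer (qvar ^ 3) (qvar\<^sup>2) k / qpochhammer qvar qvar k * qvar ^ k)
    ((-1) ^ (m + 1) * qvar ^ (m * (m + 1) - 2) + (1 + qvar) / qvar\<^sup>2 * qint qvar n)"
    (is "cong_mod_square _ ?A ?B")
proof -
  define f where "f = (\<lambda>z::complex.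
    (\<Sum>k<n. qpochhammer (z ^ 3) (z\<^sup>2) k / qpochhammer z z k * z ^ k) -
    ((-1) ^ (m + 1) * z ^ (m * (m + 1) - 2) + (1 + z) / z\<^sup>2 * qint z n))"
  define u where "u = (\<lambda>z::complex. qsum n z z - (-1) ^ m * z ^ (m * (m + 1)))"
  define v where "v = (\<lambda>z::complex. qpochhammer z (z\<^sup>2) n / qpochhammer z z (2 * m) - (1 - z ^ n))"
  \<comment> \<open>The squared term is the error in replacing 1 + z^(n+1) by 1 + z: (1 + z^(n+1))
    (1 - z^n) - (1 + z) (1 - z^n) = - z (1 - z^n)^2.\<close>
  define g where "g = (\<lambda>z::complex. inverse (z\<^sup>2) *
    (inverse (1 - z) * ((1 + z ^ (n + 1)) * v z - z * ((1 - z ^ n) * (1 - z ^ n))) - u z))"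
  have U: "primitive_unity_roots n \<subseteq> punctured n" "punctured n \<noteq> {}"
    using primitive_unity_roots_punctured[of n] punctured_nonempty[of n] by (simp_all add: n)
  have nz: "qpochhammer z z k \<noteq> 0" if "z \<in> punctured n" "k < n" for z k
    using punctured_power_neq_1[OF that(1)] that(2) by (intro qpochhammer_self_nonzero) auto
  have ev: "evaluates (punctured n) (?A - ?B) f"
    unfolding f_def using nz U punctured_nonzero
    by (intro evaluates_intros evaluates_qpochhammer evaluates_qint) auto
  have f: "g z = f z" if "z \<in> punctured n" for z
  proof -
    have z: "z \<noteq> 0" using punctured_nonzero[OF that] .
    have z1: "1 - z \<noteq> 0" using punctured_power_neq_1[OF that, of 1] n m by auto
    define D where "D = qpochhammer z z (2 * m)"
    define W where "W = qpochhammer (z ^ 3) (z\<^sup>2) (2 * m)"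
    define a where "a = z ^ n"
    have D: "D \<noteq> 0" unfolding D_def using nz[OF that] by (simp add: n)
    have 0: "z\<^sup>2 * ((1 + z) / z\<^sup>2 * qint z n) = (1 + z) * qint z n" using z by simp
    have 1: "qsum n z z + z * z * qsum n z (z ^ 3) = (1 + z * a) * W / D"
      using qsum_functional_equation[of "2 * m" z z] punctured_power_neq_1[OF that]
      by (simp add: n W_def D_def a_def power3_eq_cube power2_eq_square mult.assoc)
    have 2: "qpochhammer z (z\<^sup>2) n = (1 - z) * W"
      unfolding W_def n Suc_eq_plus1[symmetric] qpochhammer_Suc_shift
      by (simp add: power3_eq_cube power2_eq_square mult.assoc)
    have 3: "z\<^sup>2 * z ^ (m * (m + 1) - 2) = z ^ (m * (m + 1))"
    proof -
      have "2 \<le> m * (m + 1)" using m mult_le_mono[of 1 m 2 "m + 1"] by simp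
      thus ?thesis unfolding power_add[symmetric] by (simp only: le_add_diff_inverse)
    qed
    have 4: "qint z n = (1 - a) / (1 - z)"
      using qint_eq[of z n] z1 by (simp add: a_def field_simps)
    have "z\<^sup>2 * f z = z * z * qsum n z (z ^ 3) + (-1) ^ m * (z\<^sup>2 * z ^ (m * (m + 1) - 2))
        - (1 + z) * qint z n"
      unfolding f_def right_diff_distrib distrib_left[of "z\<^sup>2"] 0
      by (simp add: qsum_def algebra_simps power2_eq_square)
    also have "\<dots> = ((1 + z * a) * W / D - qsum n z z) + (-1) ^ m * z ^ (m * (m + 1))
        - (1 + z) * ((1 - a) / (1 - z))"
      unfolding 3 4 1[symmetric] by simp
    also have "\<dots> = inverse (1 - z) * ((1 + z * a) * v z - z * ((1 - a) * (1 - a))) - u z"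
    proof -
      have "(1 + z * a) * W / D - (1 + z) * ((1 - a) / (1 - z))
        = inverse (1 - z) * ((1 + z * a) * v z - z * ((1 - a) * (1 - a)))"
        unfolding v_def 2 D_def[symmetric] a_def[symmetric]
        using D z1 by (simp add: divide_simps) algebra
      thus ?thesis by (simp add: u_def)
    qed
    also have "\<dots> = z\<^sup>2 * g z"
      using z by (simp add: g_def a_def)
    finally show ?thesis using z by simp
  qed
  show ?thesis
  proof (rule cong_mod_squareI[OF _ ev open_punctured U(1)])
    fix \<zeta> assume \<zeta>: "\<zeta> \<in> primitive_unity_roots n"
    interpret odd_primitive_root n m \<zeta> by unfold_locales (use n m \<zeta> in auto)
    have \<zeta>1: "1 - \<zeta> \<noteq> 0" using root_power_neq_1[of 1] m by auto
    have d: "((\<lambda>z. 1 - z ^ n) has_field_derivative - (of_nat n * \<zeta> ^ (n - 1))) (at \<zeta>)"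
      "((\<lambda>z. 1 + z ^ (n + 1)) has_field_derivative of_nat (n + 1) * \<zeta> ^ n) (at \<zeta>)"
      "((\<lambda>z. inverse (1 - z)) has_field_derivative inverse ((1 - \<zeta>)\<^sup>2)) (at \<zeta>)"
      "((\<lambda>z. inverse (z\<^sup>2)) has_field_derivative - (2 * \<zeta>) * inverse ((\<zeta>\<^sup>2)\<^sup>2)) (at \<zeta>)"
      using \<zeta>1 root_nonzero
      by (auto intro!: derivative_eq_intros simp: power2_eq_square simp del: power_Suc)
    have uv: "double_zero u \<zeta>" "double_zero v \<zeta>"
      unfolding u_def v_def by (rule qsum_diagonal qpochhammer_square_full)+
    have "double_zero g \<zeta>"
      unfolding g_def
      by (intro double_zero_mult[OF d(4)] double_zero_mult[OF d(3)] double_zero_mult[OF d(2)]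
          double_zero_mult[OF DERIV_ident] double_zero_mult_zeros[OF d(1) d(1)] double_zero_diff
          uv) (simp_all add: root_power_n)
    thus "double_zero f \<zeta>"
      by (rule double_zero_cong[OF _ open_punctured root_punctured f])
  qed (use n in auto)
qed

theorem theorem1p2:
  fixes n :: nat
  assumes "n > 1" and "odd n"
  shows "cong_mod_square (cyclotomic n)
           (\<Sum>k=0..n-1. qpochhammer qvar (qvar ^ 2) k / qpochhammer qvar qvar k * qvar ^ (2 * k))
           ((- 1) ^ ((n - 1) div 2) * qvar ^ ((n ^ 2 - 5) div 4) + (qvar - 1) / qvar * qint qvar n)
       \<and> cong_mod_square (cyclotomic n)
           (\<Sum>k=0..n-1. qpochhammer (qvar ^ 3) (qvar ^ 2) k / qpochhammer qvar qvar k * qvar ^ k)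
           ((- 1) ^ ((n + 1) div 2) * qvar ^ ((n ^ 2 - 9) div 4) + (1 + qvar) / qvar ^ 2 * qint qvar n)"
proof -
  obtain m where n: "n = 2 * m + 1" using \<open>odd n\<close> by (elim oddE)
  have m: "m > 0" using \<open>n > 1\<close> n by simp
  \<comment> \<open>Hence n^2 - 5 and n^2 - 9 are divisible by 4, and m (m + 1) >= 2 keeps the
    natural-number subtractions exact.\<close>
  have sq: "n ^ 2 = 4 * (m * (m + 1)) + 1" by (simp add: n power2_eq_square algebra_simps)
  have eqs: "{0..n - 1} = {..<n}" "(n - 1) div 2 = m" "(n + 1) div 2 = m + 1"
    "(n ^ 2 - 5) div 4 = m * (m + 1) - 1" "(n ^ 2 - 9) div 4 = m * (m + 1) - 2"
    unfolding sq by (auto simp: n)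
  show ?thesis
    unfolding eqs using qsum_q2_cong[OF n m] qsum_cube_cong[OF n m] by (rule conjI)
qed

end
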